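(* Let $\mathcal{H}$ be a Hilbert space, $H\ge0$ a selfadjoint operator in $\mathcal{H}$, and $V\ge0$ a bounded selfadjoint operator in $\mathcal{H}$. Let $\mathcal{K}\subset\mathcal{H}$ be a closed reducing subspace for $H$ such that, for some $c,v>0$, $$(H\xi|\xi)\ge c\|\xi\|^2\quad\text{for all }\xi\in\mathcal{K}^\perp\cap\mathrm{dom}(H),\qquad (V\zeta|\zeta)\ge v\|\zeta\|^2\quad\text{for all }\zeta\in\mathcal{K}.$$ Then $$H+V\ge\frac{cv}{c+2\|V\|}.$$
   Context: $(\cdot|\cdot)$ is the inner product of $\mathcal{H}$. For a selfadjoint operator $A$ and $\varepsilon\in\mathbb{R}$, $A\ge\varepsilon$ means $(Af|f)\ge\varepsilon(f|f)$ for all $f\in\mathrm{dom}(A)$. $H$ may be unbounded, and $H+V$ has domain $\mathrm{dom}(H)$. A closed subspace $\mathcal{K}$ of $\mathcal{H}$ is called reducing for $H$ if $\mathcal{K}\subset\mathrm{dom}(H)$ and $P_{\mathcal{K}}H\subset HP_{\mathcal{K}}$, where $P_{\mathcal{K}}$ is the orthogonal projection onto $\mathcal{K}$ (in particular, $P_{\mathcal{K}}\eta\in\mathrm{dom}(H)$ for $\eta\in\mathrm{dom}(H)$, and both $\mathcal{K}$ and $\mathcal{K}^\perp$ are invariant under $H$). $\mathcal{K}^\perp$ is the orthogonal complement of $\mathcal{K}$, and $\|V\|$ is the operator norm of $V$.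
   Formalization: The subspace K is assumed to be nonzero; for K = {0} the claim fails, since the condition on V is then vacuous (take V = 0, H = c times the identity and v > c). *)

theory Defs
  imports "HOL-Analysis.Analysis" "HOL-Library.Complex_Order"
begin

text \<open>
  Complex inner product spaces, as a complex structure on a real inner product space whose inner
  product is the real part of the complex one. Thus the norm, the metric and the topology are those
  of the complex inner product, and a complex Hilbert space is a type of sort
  \<open>{complex_inner, complete_space}\<close>. The inner product is linear in its first argument.
  The order on the complex numbers is the one of \<open>Complex_Order\<close>: \<open>z \<le> w\<close> means that
  \<open>w - z\<close> is real and nonnegative.
\<close>

class complex_inner = real_inner +
  fixes scaleC :: "complex \<Rightarrow> 'a \<Rightarrow> 'a"  (infixr "*\<^sub>C" 75)
    and cinner :: "'a \<Rightarrow> 'a \<Rightarrow> complex"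
  assumes scaleC_add_right: "a *\<^sub>C (x + y) = a *\<^sub>C x + a *\<^sub>C y"
    and scaleC_add_left: "(a + b) *\<^sub>C x = a *\<^sub>C x + b *\<^sub>C x"
    and scaleC_scaleC: "a *\<^sub>C b *\<^sub>C x = (a * b) *\<^sub>C x"
    and scaleC_of_real: "complex_of_real r *\<^sub>C x = r *\<^sub>R x"
    and cinner_commute: "cinner x y = cnj (cinner y x)"
    and cinner_add_left: "cinner (x + y) z = cinner x z + cinner y z"
    and cinner_scaleC_left: "cinner (a *\<^sub>C x) y = a * cinner x y"
    and Re_cinner: "Re (cinner x y) = inner x y"

lemma scaleC_one: "1 *\<^sub>C x = (x :: 'a::complex_inner)"
  using scaleC_of_real[of 1 x] by simp

lemma cinner_self: "cinner x x = complex_of_real ((norm x)\<^sup>2)"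
  using cinner_commute[of x x] by (simp add: complex_eq_iff Re_cinner power2_norm_eq_inner)

global_interpretation complex_space:
  vector_space "scaleC :: complex \<Rightarrow> 'a \<Rightarrow> 'a::complex_inner"
  defines csubspace = complex_space.subspace
  by unfold_locales (simp_all add: scaleC_add_right scaleC_add_left scaleC_scaleC scaleC_one)

instantiation complex :: complex_inner
begin

definition scaleC_complex :: "complex \<Rightarrow> complex \<Rightarrow> complex"
  where "scaleC_complex a x = a * x"

definition cinner_complex :: "complex \<Rightarrow> complex \<Rightarrow> complex"
  where "cinner_complex x y = x * cnj y"

instance
  by standard (simp_all add: scaleC_complex_def cinner_complex_def inner_complex_def
      algebra_simps scaleR_conv_of_real)

end

definition orth_compl :: "'a::complex_inner set \<Rightarrow> 'a set"
  where "orth_compl K = {x. \<forall>y\<in>K. cinner x y = 0}"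

text \<open>For a closed subspace of a Hilbert space, such a point exists and is unique.\<close>

definition orth_proj :: "'a::complex_inner set \<Rightarrow> 'a \<Rightarrow> 'a"
  where "orth_proj K x = (THE p. p \<in> K \<and> x - p \<in> orth_compl K)"

text \<open>
  An operator is given by its domain \<open>D\<close> and a function \<open>A\<close>, whose values outside of
  \<open>D\<close> play no role.
\<close>

definition clinear_on :: "'a::complex_inner set \<Rightarrow> ('a \<Rightarrow> 'a) \<Rightarrow> bool"
  where "clinear_on D A \<longleftrightarrow> csubspace D \<and>
    (\<forall>x\<in>D. \<forall>y\<in>D. A (x + y) = A x + A y) \<and> (\<forall>a. \<forall>x\<in>D. A (a *\<^sub>C x) = a *\<^sub>C A x)"

definition adjoint_dom :: "'a::complex_inner set \<Rightarrow> ('a \<Rightarrow> 'a) \<Rightarrow> 'a set"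
  where "adjoint_dom D A = {y. \<exists>z. \<forall>x\<in>D. cinner (A x) y = cinner x z}"

text \<open>The point is unique for densely defined operators.\<close>

definition adjoint_op :: "'a::complex_inner set \<Rightarrow> ('a \<Rightarrow> 'a) \<Rightarrow> 'a \<Rightarrow> 'a"
  where "adjoint_op D A y = (THE z. \<forall>x\<in>D. cinner (A x) y = cinner x z)"

definition selfadjoint_on :: "'a::complex_inner set \<Rightarrow> ('a \<Rightarrow> 'a) \<Rightarrow> bool"
  where "selfadjoint_on D A \<longleftrightarrow> clinear_on D A \<and> closure D = UNIV \<and>
    adjoint_dom D A = D \<and> (\<forall>y\<in>D. adjoint_op D A y = A y)"

definition op_ge :: "'a::complex_inner set \<Rightarrow> ('a \<Rightarrow> 'a) \<Rightarrow> real \<Rightarrow> bool"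
  where "op_ge D A e \<longleftrightarrow> (\<forall>f\<in>D. cinner (A f) f \<ge> complex_of_real e * cinner f f)"

text \<open>
  The last two conjuncts of the following definition say that the operator \<open>P A\<close>, with domain
  \<open>D\<close>, is a restriction of \<open>A P\<close>, with domain \<open>{x. P x \<in> D}\<close>, where \<open>P\<close> is the
  orthogonal projection onto \<open>K\<close>.
\<close>

definition reducing_subspace :: "'a::complex_inner set \<Rightarrow> ('a \<Rightarrow> 'a) \<Rightarrow> 'a set \<Rightarrow> bool"
  where "reducing_subspace D A K \<longleftrightarrow> csubspace K \<and> closed K \<and> K \<subseteq> D \<and>
    D \<subseteq> {x. orth_proj K x \<in> D} \<and> (\<forall>x\<in>D. orth_proj K (A x) = A (orth_proj K x))"

end

theory Submission
  imports Defs
begin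

text \<open>
  Split \<open>f \<in> D\<close> as \<open>f = p + q\<close> with \<open>p = P f \<in> K\<close> and \<open>q \<in> K\<^sup>\<bottom>\<close>. As \<open>K\<close> reduces
  \<open>H\<close>, the cross terms of \<open>(H f | f)\<close> vanish, so \<open>(H f | f) \<ge> c \<parallel>q\<parallel>\<^sup>2\<close>. The form of \<open>V\<close> is a
  seminorm squared, so the triangle inequality for \<open>p = f - q\<close> combined with Young's inequality
  gives, for every \<open>t > 0\<close>, the bound \<open>(V f | f) \<ge> (V p | p) / (1 + t) - (V q | q) / t\<close>
  (lemma \<open>nonneg_form_add_ge\<close>). With \<open>t = 2 \<parallel>V\<parallel> / c\<close> the right-hand side is at least
  \<open>(c v / (c + 2 \<parallel>V\<parallel>)) \<parallel>p\<parallel>\<^sup>2 - (c / 2) \<parallel>q\<parallel>\<^sup>2\<close>, and half of the bound for \<open>H\<close> is left over on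
  \<open>K\<^sup>\<bottom>\<close>. That half suffices because \<open>v \<le> \<parallel>V\<parallel>\<close>, which holds as \<open>K \<noteq> {0}\<close>.

  The remaining ingredient is the projection theorem for closed subspaces of a Hilbert space,
  proved by a minimizing sequence (lemma \<open>closed_subspace_orthogonal_decomposition\<close>).
\<close>

section \<open>Orthogonal projections in Hilbert spaces\<close>

lemma parallelogram_midpoint:
  fixes x y z :: "'a::real_inner"
  shows "(norm (y - z))\<^sup>2 =
    2 * (norm (x - y))\<^sup>2 + 2 * (norm (x - z))\<^sup>2 - 4 * (norm (x - (1/2) *\<^sub>R (y + z)))\<^sup>2"
  by (simp add: power2_norm_eq_inner inner_diff_left inner_diff_right inner_add_left
      inner_add_right inner_commute algebra_simps)

lemma closest_point_in_subspace_orthogonal: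
  fixes x p :: "'a::real_inner"
  assumes K: "subspace K" "p \<in> K"
    and min: "\<And>y. y \<in> K \<Longrightarrow> (norm (x - p))\<^sup>2 \<le> (norm (x - y))\<^sup>2"
    and k: "k \<in> K"
  shows "inner (x - p) k = 0"
proof (cases "k = 0")
  case False
  define t where "t = inner (x - p) k / inner k k"
  have "p + t *\<^sub>R k \<in> K"
    using K k by (simp add: subspace_add subspace_scale)
  then have "(norm (x - p))\<^sup>2 \<le> (norm ((x - p) - t *\<^sub>R k))\<^sup>2"
    using min by (simp add: diff_diff_eq)
  also have "\<dots> = (norm (x - p))\<^sup>2 - 2 * t * inner (x - p) k + t * t * inner k k"
    unfolding power2_norm_eq_inner inner_diff_left[of "x - p"] inner_diff_right[of _ "x - p"]
      inner_scaleR_left inner_scaleR_right inner_commute[of k "x - p"]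
    by algebra
  also have "\<dots> = (norm (x - p))\<^sup>2 - (inner (x - p) k)\<^sup>2 / inner k k"
    using False by (simp add: t_def power2_eq_square)
  finally have "(inner (x - p) k)\<^sup>2 / inner k k \<le> 0"
    by simp
  moreover have "inner k k > 0"
    using False by simp
  ultimately have "(inner (x - p) k)\<^sup>2 \<le> 0"
    by (simp add: divide_le_0_iff)
  then show ?thesis
    by simp
qed simp

lemma closed_subspace_orthogonal_decomposition:
  fixes x :: "'a::{real_inner, complete_space}"
  assumes K: "subspace K" "closed K"
  shows "\<exists>p\<in>K. \<forall>k\<in>K. inner (x - p) k = 0"
proof -
  define d where "d = Inf ((\<lambda>y. (norm (x - y))\<^sup>2) ` K)"
  have ne: "(\<lambda>y. (norm (x - y))\<^sup>2) ` K \<noteq> {}"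
    using subspace_0[OF K(1)] by auto
  have d_le: "d \<le> (norm (x - y))\<^sup>2" if "y \<in> K" for y
    unfolding d_def by (rule cInf_lower) (use that in \<open>auto intro: bdd_belowI[of _ 0]\<close>)
  have "\<exists>y\<in>K. (norm (x - y))\<^sup>2 < d + inverse (real (Suc n))" for n
    using cInf_lessD[OF ne, of "d + inverse (real (Suc n))"] unfolding d_def[symmetric] by auto
  then obtain y where yK: "\<And>n. y n \<in> K"
    and y: "\<And>n. (norm (x - y n))\<^sup>2 < d + inverse (real (Suc n))"
    by metis
  have dist_y: "(norm (y m - y n))\<^sup>2 < 2 * inverse (real (Suc m)) + 2 * inverse (real (Suc n))" for m n
  proof -
    have "(1/2) *\<^sub>R (y m + y n) \<in> K"
      using K(1) yK by (intro subspace_scale subspace_add)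
    from d_le[OF this] show ?thesis
      using y[of m] y[of n] unfolding parallelogram_midpoint[of "y m" "y n" x] by linarith
  qed
  have "Cauchy y"
  proof (rule CauchyI)
    fix e :: real
    assume e: "0 < e"
    then obtain N where N: "inverse (real (Suc N)) < e\<^sup>2 / 4"
      using reals_Archimedean[of "e\<^sup>2 / 4"] by auto
    have "norm (y m - y n) < e" if "m \<ge> N" "n \<ge> N" for m n
    proof -
      have "inverse (real (Suc m)) \<le> inverse (real (Suc N))"
        "inverse (real (Suc n)) \<le> inverse (real (Suc N))"
        using that by (auto intro!: le_imp_inverse_le)
      then have "(norm (y m - y n))\<^sup>2 < e\<^sup>2"
        using dist_y[of m n] N by linarith
      then show ?thesis
        using e by (simp add: power_less_imp_less_base)
    qed
    then show "\<exists>M. \<forall>m\<ge>M. \<forall>n\<ge>M. norm (y m - y n) < e"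
      by blast
  qed
  then obtain p where p: "y \<longlonglongrightarrow> p"
    using Cauchy_convergent convergentD by blast
  have pK: "p \<in> K"
    using closed_sequentially[OF K(2) _ p] yK by blast
  have "(norm (x - p))\<^sup>2 \<le> d"
  proof (rule LIMSEQ_le)
    show "(\<lambda>n. (norm (x - y n))\<^sup>2) \<longlonglongrightarrow> (norm (x - p))\<^sup>2"
      by (intro tendsto_intros p)
    show "(\<lambda>n. d + inverse (real (Suc n))) \<longlonglongrightarrow> d"
      by (rule LIMSEQ_inverse_real_of_nat_add)
    show "\<exists>N. \<forall>n\<ge>N. (norm (x - y n))\<^sup>2 \<le> d + inverse (real (Suc n))"
      using y less_imp_le by blast
  qed
  then have "(norm (x - p))\<^sup>2 \<le> (norm (x - z))\<^sup>2" if "z \<in> K" for z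
    using d_le[OF that] by linarith
  then show ?thesis
    using closest_point_in_subspace_orthogonal[OF K(1) pK] pK by blast
qed

lemma csubspace_imp_subspace:
  fixes K :: "'a::complex_inner set"
  assumes "csubspace K"
  shows "subspace K"
  unfolding subspace_def
  using complex_space.subspace_0[OF assms] complex_space.subspace_add[OF assms]
    complex_space.subspace_scale[OF assms] by (metis scaleC_of_real)

lemma inner_imaginary_scaleC: "inner x (\<i> *\<^sub>C y) = Im (cinner x y)"
proof -
  have "cinner x (\<i> *\<^sub>C y) = cnj \<i> * cinner x y"
    by (metis cinner_commute cinner_scaleC_left complex_cnj_mult)
  then show ?thesis
    by (simp flip: Re_cinner)
qed

text \<open>On a complex subspace, orthogonality for the real and for the complex inner product agree.\<close>

lemma mem_orth_compl_iff_inner: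
  assumes "csubspace K"
  shows "x \<in> orth_compl K \<longleftrightarrow> (\<forall>k\<in>K. inner x k = 0)"
proof
  assume "x \<in> orth_compl K"
  then show "\<forall>k\<in>K. inner x k = 0"
    by (simp add: orth_compl_def flip: Re_cinner)
next
  assume r: "\<forall>k\<in>K. inner x k = 0"
  have "cinner x k = 0" if "k \<in> K" for k
  proof -
    have "\<i> *\<^sub>C k \<in> K"
      using complex_space.subspace_scale[OF assms that] .
    then show ?thesis
      using r that by (simp add: complex_eq_iff Re_cinner flip: inner_imaginary_scaleC)
  qed
  then show "x \<in> orth_compl K"
    by (simp add: orth_compl_def)
qed

lemma orth_proj_unique:
  assumes K: "csubspace K" and p: "p \<in> K" "x - p \<in> orth_compl K"
  shows "orth_proj K x = p"
  unfolding orth_proj_def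
proof (rule the_equality)
  fix r
  assume r: "r \<in> K \<and> x - r \<in> orth_compl K"
  have "r - p \<in> K"
    using complex_space.subspace_diff[OF K] r p by blast
  then have "inner (x - p) (r - p) = 0" "inner (x - r) (r - p) = 0"
    using r p by (auto simp: mem_orth_compl_iff_inner[OF K])
  then have "inner (r - p) (r - p) = 0"
    by (simp add: inner_diff_left)
  then show "r = p"
    by simp
qed (use p in simp)

lemma orth_proj_decomposition:
  fixes x :: "'a::{complex_inner, complete_space}"
  assumes K: "csubspace K" "closed K"
  shows "orth_proj K x \<in> K" "x - orth_proj K x \<in> orth_compl K"
proof -
  obtain p where "p \<in> K" "x - p \<in> orth_compl K"
    using closed_subspace_orthogonal_decomposition[OF csubspace_imp_subspace[OF K(1)] K(2)]
      mem_orth_compl_iff_inner[OF K(1)] by blast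
  then show "orth_proj K x \<in> K" "x - orth_proj K x \<in> orth_compl K"
    using orth_proj_unique[OF K(1)] by auto
qed

lemma reducing_subspace_invariant:
  fixes A :: "'a::{complex_inner, complete_space} \<Rightarrow> 'a"
  assumes "reducing_subspace D A K" and "p \<in> K"
  shows "A p \<in> K"
proof -
  have K: "csubspace K" "closed K" and PA: "orth_proj K (A p) = A (orth_proj K p)"
    using assms by (auto simp: reducing_subspace_def)
  have "orth_proj K p = p"
    using assms(2) by (intro orth_proj_unique[OF K(1)]) (auto simp: mem_orth_compl_iff_inner[OF K(1)])
  then show ?thesis
    using PA orth_proj_decomposition(1)[OF K, of "A p"] by simp
qed

lemma reducing_subspace_invariant_orth_compl:
  fixes A :: "'a::{complex_inner, complete_space} \<Rightarrow> 'a"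
  assumes "reducing_subspace D A K" and "clinear_on D A" and "q \<in> orth_compl K" "q \<in> D"
  shows "A q \<in> orth_compl K"
proof -
  have K: "csubspace K" "closed K" and PA: "orth_proj K (A q) = A (orth_proj K q)"
    using assms by (auto simp: reducing_subspace_def)
  have "orth_proj K q = 0"
    using assms(3) complex_space.subspace_0[OF K(1)] by (intro orth_proj_unique[OF K(1)]) auto
  moreover have "A 0 = 0"
    using assms(2,4) unfolding clinear_on_def
    by (metis complex_space.scale_zero_left)
  ultimately show ?thesis
    using PA orth_proj_decomposition(2)[OF K, of "A q"] by simp
qed

section \<open>Lower bounds for the two forms\<close>

text \<open>
  A lower bound of an operator contains the assertion that its form is real, since the order on
  the complex numbers compares real parts and requires equal imaginary parts.
\<close>

lemma of_real_le_cinner_iff: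
  "complex_of_real r \<le> cinner x y \<longleftrightarrow> r \<le> inner x y \<and> Im (cinner x y) = 0"
  by (auto simp: less_eq_complex_def Re_cinner)

lemma op_ge_iff:
  "op_ge D A e \<longleftrightarrow> (\<forall>f\<in>D. e * (norm f)\<^sup>2 \<le> inner (A f) f \<and> Im (cinner (A f) f) = 0)"
proof -
  have "complex_of_real e * cinner f f = complex_of_real (e * (norm f)\<^sup>2)" for f :: 'a
    by (simp add: cinner_self)
  then show ?thesis
    unfolding op_ge_def by (simp only: of_real_le_cinner_iff)
qed

lemma nonneg_form_add_ge:
  fixes V :: "'a::real_inner \<Rightarrow> 'a"
  assumes V: "linear V" "\<And>x. 0 \<le> inner (V x) x" and t: "t > 0"
  shows "inner (V p) p / (1 + t) - inner (V q) q / t \<le> inner (V (p + q)) (p + q)"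
proof -
  define A B C where "A = inner (V p) p" and "B = inner (V q) q"
    and "C = inner (V p) q + inner (V q) p"
  \<comment> \<open>The vector is \<open>t (p + q) + q\<close>: nonnegativity there is Young's inequality for the cross
    terms of \<open>p + q\<close> and \<open>q\<close>.\<close>
  have "0 \<le> inner (V (t *\<^sub>R p + (1 + t) *\<^sub>R q)) (t *\<^sub>R p + (1 + t) *\<^sub>R q)"
    by (rule V(2))
  also have "\<dots> = t * t * A + t * (1 + t) * C + (1 + t) * (1 + t) * B"
    unfolding linear_add[OF V(1)] linear_scale[OF V(1)] inner_add_left inner_add_right
      inner_scaleR_left inner_scaleR_right A_def B_def C_def
    by algebra
  also have "\<dots> = t * (1 + t) * ((A + B + C) - (A / (1 + t) - B / t))"
  proof -
    have "t * (1 + t) * (A / (1 + t)) = t * A" "t * (1 + t) * (B / t) = (1 + t) * B"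
      using t by (simp_all add: field_simps)
    then show ?thesis
      unfolding right_diff_distrib by (simp only:) (simp add: algebra_simps)
  qed
  finally have "A / (1 + t) - B / t \<le> A + B + C"
    using mult_pos_pos[OF t, of "1 + t"] t unfolding zero_le_mult_iff[of "t * (1 + t)"] by linarith
  also have "A + B + C = inner (V (p + q)) (p + q)"
    by (simp add: linear_add[OF V(1)] inner_add_left inner_add_right A_def B_def C_def)
  finally show ?thesis
    by (simp add: A_def B_def)
qed

lemma inner_le_onorm:
  assumes "bounded_linear V"
  shows "inner (V x) x \<le> onorm V * (norm x)\<^sup>2"
proof -
  have "inner (V x) x \<le> norm (V x) * norm x"
    by (rule norm_cauchy_schwarz)
  also have "\<dots> \<le> (onorm V * norm x) * norm x"
    using onorm[OF assms] by (intro mult_right_mono) auto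
  finally show ?thesis
    by (simp add: power2_eq_square)
qed

lemma reducing_subspace_form_add:
  fixes H :: "'a::{complex_inner, complete_space} \<Rightarrow> 'a"
  assumes red: "reducing_subspace D H K" and lin: "clinear_on D H"
    and p: "p \<in> K" and q: "q \<in> orth_compl K" "q \<in> D"
  shows "inner (H (p + q)) (p + q) = inner (H p) p + inner (H q) q"
proof -
  have K: "csubspace K" and "p \<in> D"
    using red p by (auto simp: reducing_subspace_def)
  then have "H (p + q) = H p + H q"
    using lin q by (simp add: clinear_on_def)
  moreover have "inner (H p) q = 0"
    using reducing_subspace_invariant[OF red p] q
    by (metis mem_orth_compl_iff_inner[OF K] inner_commute)
  moreover have "inner (H q) p = 0"
    using reducing_subspace_invariant_orth_compl[OF red lin q] p
    by (simp add: mem_orth_compl_iff_inner[OF K])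
  ultimately show ?thesis
    by (simp add: inner_add_left inner_add_right)
qed

section \<open>The lower bound for the sum\<close>

theorem theorem3p2:
  fixes D :: "'a::{complex_inner, complete_space} set"
    and H V :: "'a \<Rightarrow> 'a"
    and K :: "'a set"
    and c v :: real
  assumes "selfadjoint_on D H" and "op_ge D H 0"
    and "bounded_linear V" and "selfadjoint_on UNIV V" and "op_ge UNIV V 0"
    and "reducing_subspace D H K" and "K \<noteq> {0}"
    and "c > 0" and "v > 0"
    and "\<forall>\<xi>\<in>orth_compl K \<inter> D. cinner (H \<xi>) \<xi> \<ge> complex_of_real (c * (norm \<xi>)\<^sup>2)"
    and "\<forall>\<zeta>\<in>K. cinner (V \<zeta>) \<zeta> \<ge> complex_of_real (v * (norm \<zeta>)\<^sup>2)"
  shows "op_ge D (\<lambda>x. H x + V x) (c * v / (c + 2 * onorm V))"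
proof -
  define W where "W = onorm V"
  have K: "csubspace K" "closed K" and KD: "K \<subseteq> D" and PD: "\<And>x. x \<in> D \<Longrightarrow> orth_proj K x \<in> D"
    using assms(6) by (auto simp: reducing_subspace_def)
  have lin: "clinear_on D H"
    using assms(1) by (simp add: selfadjoint_on_def)
  have D: "csubspace D"
    using lin by (simp add: clinear_on_def)
  have H0: "0 \<le> inner (H x) x" "Im (cinner (H x) x) = 0" if "x \<in> D" for x
    using assms(2) that by (auto simp: op_ge_iff)
  have V0: "0 \<le> inner (V x) x" "Im (cinner (V x) x) = 0" for x
    using assms(5) by (auto simp: op_ge_iff)
  have Hc: "c * (norm x)\<^sup>2 \<le> inner (H x) x" if "x \<in> orth_compl K" "x \<in> D" for x
    using assms(10) that unfolding of_real_le_cinner_iff by blast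
  have Vv: "v * (norm x)\<^sup>2 \<le> inner (V x) x" if "x \<in> K" for x
    using assms(11) that unfolding of_real_le_cinner_iff by blast
  have VW: "inner (V x) x \<le> W * (norm x)\<^sup>2" for x
    unfolding W_def by (rule inner_le_onorm[OF assms(3)])
  have vW: "v \<le> W"
  proof -
    obtain k where k: "k \<in> K" "k \<noteq> 0"
      using assms(7) complex_space.subspace_0[OF K(1)] by blast
    then have "v * (norm k)\<^sup>2 \<le> W * (norm k)\<^sup>2"
      using Vv VW order_trans by blast
    then show ?thesis
      using k by simp
  qed
  then have W: "W > 0"
    using assms(9) by simp
  define e where "e = c * v / (c + 2 * W)"
  define t where "t = 2 * W / c"
  have t: "t > 0"
    using W assms(8) by (simp add: t_def)
  have e_le: "e \<le> c / 2"
  proof -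
    have "c * (2 * v) \<le> c * (c + 2 * W)"
      using vW assms(8) by (intro mult_left_mono) auto
    then show ?thesis
      using W assms(8) by (simp add: e_def divide_le_eq field_simps)
  qed
  have e_t: "v / (1 + t) = e" "W / t = c / 2"
    using W assms(8) by (simp_all add: e_def t_def field_simps)
  have "e * (norm f)\<^sup>2 \<le> inner (H f + V f) f \<and> Im (cinner (H f + V f) f) = 0" if f: "f \<in> D" for f
  proof
    define p where "p = orth_proj K f"
    define q where "q = f - p"
    have fpq: "f = p + q"
      by (simp add: q_def)
    have p: "p \<in> K" and q: "q \<in> orth_compl K"
      using orth_proj_decomposition[OF K, of f] by (auto simp: p_def q_def)
    have qD: "q \<in> D"
      using complex_space.subspace_diff[OF D f PD[OF f]] by (simp add: q_def p_def)
    have pyth: "(norm f)\<^sup>2 = (norm p)\<^sup>2 + (norm q)\<^sup>2"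
    proof -
      have "inner q p = 0"
        using p q by (simp add: mem_orth_compl_iff_inner[OF K(1)])
      then show ?thesis
        by (simp add: fpq power2_norm_eq_inner inner_add_left inner_add_right inner_commute)
    qed
    have Hf: "c * (norm q)\<^sup>2 \<le> inner (H f) f"
      using reducing_subspace_form_add[OF assms(6) lin p q qD] H0(1)[of p] Hc[OF q qD] p KD
      by (auto simp: fpq)
    have "e * (norm p)\<^sup>2 - c / 2 * (norm q)\<^sup>2 = v * (norm p)\<^sup>2 / (1 + t) - W * (norm q)\<^sup>2 / t"
      by (simp flip: e_t)
    also have "\<dots> \<le> inner (V p) p / (1 + t) - inner (V q) q / t"
      using t Vv[OF p] VW[of q] by (intro diff_mono divide_right_mono) auto
    also have "\<dots> \<le> inner (V f) f"
      unfolding fpq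
      by (rule nonneg_form_add_ge[OF bounded_linear.linear[OF assms(3)] V0(1) t])
    finally have Vf: "e * (norm p)\<^sup>2 - c / 2 * (norm q)\<^sup>2 \<le> inner (V f) f" .
    have "e * (norm q)\<^sup>2 \<le> c / 2 * (norm q)\<^sup>2"
      using e_le by (intro mult_right_mono) auto
    then show "e * (norm f)\<^sup>2 \<le> inner (H f + V f) f"
      using Hf Vf unfolding pyth inner_add_left by (simp add: algebra_simps)
    show "Im (cinner (H f + V f) f) = 0"
      using H0(2)[OF f] V0(2) by (simp add: cinner_add_left)
  qed
  then show ?thesis
    by (simp add: op_ge_iff e_def W_def)
qed

end
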